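(* Let $(A,\|\cdot\|)$ be an absolute-valued algebra with left unit $e$. Then the following are equivalent: (1) $(x^2,x^2,x^2)=0$ for all $x\in A$; (2) $x^2e=x^2$ for all $x\in A$. Under these conditions $A$ is finite-dimensional of degree $\le 4$, and $(xe)e=x$ for all $x\in A$.
   Context: An absolute-valued algebra is a nonzero real algebra $A$ with a norm satisfying $\|xy\|=\|x\|\|y\|$. The associator is $(x,y,z)=(xy)z-x(yz)$. A left unit $e$ satisfies $ex=x$ for all $x$. The degree of a finite-dimensional algebra is the smallest $n$ such that every single-generated subalgebra has dimension $\le n$. *)

theory Defs
  imports "HOL-Analysis.Analysis"
begin

definition associator :: "('a \<Rightarrow> 'a \<Rightarrow> 'a::real_vector) \<Rightarrow> 'a \<Rightarrow> 'a \<Rightarrow> 'a \<Rightarrow> 'a" where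
  "associator m x y z = m (m x y) z - m x (m y z)"

definition absolute_valued_algebra :: "('a \<Rightarrow> 'a \<Rightarrow> 'a::real_normed_vector) \<Rightarrow> bool" where
  "absolute_valued_algebra m \<longleftrightarrow> bilinear m \<and> (\<exists>x::'a. x \<noteq> 0) \<and>
     (\<forall>x y. norm (m x y) = norm x * norm y)"

definition is_left_unit :: "('a \<Rightarrow> 'a \<Rightarrow> 'a) \<Rightarrow> 'a \<Rightarrow> bool" where
  "is_left_unit m e \<longleftrightarrow> (\<forall>x. m e x = x)"

definition finite_dimensional_space :: "'a::real_vector itself \<Rightarrow> bool" where
  "finite_dimensional_space TYPE('a) \<longleftrightarrow> (\<exists>B::'a set. finite B \<and> span B = UNIV)"

definition subalg_gen :: "('a \<Rightarrow> 'a \<Rightarrow> 'a::real_vector) \<Rightarrow> 'a \<Rightarrow> 'a set" where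
  "subalg_gen m x = \<Inter>{S. subspace S \<and> x \<in> S \<and> (\<forall>a\<in>S. \<forall>b\<in>S. m a b \<in> S)}"

definition alg_degree :: "('a \<Rightarrow> 'a \<Rightarrow> 'a::real_vector) \<Rightarrow> nat" where
  "alg_degree m = (LEAST n. \<forall>x. dim (subalg_gen m x) \<le> n)"

end

theory Submission
  imports Defs
begin

text \<open>If the left multiplications by \<open>u\<close> and \<open>v\<close> commute then \<open>u\<close> and \<open>v\<close> satisfy the parallelogram
  law, so every plane through \<open>e\<close> is Euclidean. Hence \<open>e\<close> has an orthogonal complement, on which
  \<open>L\<^sub>h\<^sup>2 = -\<parallel>h\<parallel>\<^sup>2\<close>. Linearizing this relation shows that the norm comes from an inner product and
  that \<open>L\<^sub>h\<close> is skew-symmetric.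

  Taking the inner product of \<open>(ww)w = w(ww)\<close> with \<open>w\<close> gives \<open>(we|w) = \<parallel>w\<parallel>\<^sup>2\<close>, that is \<open>we = w\<close>; this
  yields (1) \<open>\<Rightarrow>\<close> (2), and the converse holds because \<open>e\<close> and \<open>w\<close> then span a copy of a subfield of
  the complex numbers. Linearizing (2) at \<open>e\<close> gives \<open>(xe)e = x\<close>, so the product \<open>(xe)y\<close> is
  absolute-valued and unital, hence finite-dimensional. Splitting the part of \<open>x\<close> orthogonal to \<open>e\<close>
  into \<open>a + b\<close> with \<open>ae = a\<close>, \<open>be = -b\<close>, the subalgebra generated by \<open>x\<close> lies in the span of
  \<open>e, a, b, ab\<close>.\<close>

text \<open>Subtracting \<open>s * \<phi> 1\<close> leaves an additive function that vanishes on the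
  integers. It is therefore 1-periodic, hence bounded, and a bounded additive function is
  zero.\<close>

lemma additive_bounded_imp_linear:
  fixes \<phi> :: "real \<Rightarrow> real"
  assumes add: "\<And>s t. \<phi> (s + t) = \<phi> s + \<phi> t"
    and bd: "\<And>s. 0 \<le> s \<Longrightarrow> s \<le> 1 \<Longrightarrow> \<bar>\<phi> s\<bar> \<le> C"
  shows "\<phi> s = s * \<phi> 1"
proof -
  define \<psi> where "\<psi> s = \<phi> s - s * \<phi> 1" for s
  have addp: "\<psi> (s + t) = \<psi> s + \<psi> t" for s t
    by (simp add: \<psi>_def add algebra_simps)
  have p0: "\<psi> 0 = 0" using addp[of 0 0] by simp
  have nat_mult: "\<psi> (real n * s) = real n * \<psi> s" for n s
    by (induction n) (simp_all add: p0 addp algebra_simps)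
  have p1: "\<psi> 1 = 0" by (simp add: \<psi>_def)
  have ofint: "\<psi> (of_int k) = 0" for k
  proof (cases k rule: int_cases2)
    case (nonneg n)
    then show ?thesis using nat_mult[of n 1] p1 by simp
  next
    case (nonpos n)
    then show ?thesis using nat_mult[of n "-1"] addp[of 1 "-1"] p0 p1 by simp
  qed
  have C: "C \<ge> 0" using bd[of 0] by simp
  have "\<bar>\<psi> t\<bar> \<le> 2 * C" for t
  proof -
    have fr: "0 \<le> frac t" "frac t \<le> 1" by (simp_all add: less_imp_le frac_lt_1)
    have "\<psi> t = \<psi> (of_int \<lfloor>t\<rfloor> + frac t)" by (simp add: frac_def)
    then have "\<psi> t = \<psi> (frac t)" by (simp only: addp ofint add_0)
    moreover have "\<bar>\<phi> (frac t)\<bar> \<le> C" using bd fr by blast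
    moreover have "\<bar>frac t * \<phi> 1\<bar> \<le> C"
      using mult_mono[of "frac t" 1 "\<bar>\<phi> 1\<bar>" C] fr bd[of 1] by (simp add: abs_mult)
    ultimately show ?thesis by (simp add: \<psi>_def)
  qed
  then have b: "real n * \<bar>\<psi> s\<bar> \<le> 2 * C" for n
    using nat_mult[of n s] by (metis abs_mult abs_of_nat)
  have "\<psi> s = 0"
  proof (rule ccontr)
    assume "\<psi> s \<noteq> 0"
    then obtain n where "2 * C < real n * \<bar>\<psi> s\<bar>"
      using reals_Archimedean3[of "\<bar>\<psi> s\<bar>"] by auto
    with b[of n] show False by simp
  qed
  then show ?thesis by (simp add: \<psi>_def)
qed

text \<open>Polarization of the norm. It is shown to be an inner product in stages: linear against
  \<open>e\<close>, then bilinear on the complement of \<open>e\<close>, then everywhere.\<close>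

definition polar :: "'a::real_normed_vector \<Rightarrow> 'a \<Rightarrow> real" where
  "polar x y = ((norm (x + y))\<^sup>2 - (norm (x - y))\<^sup>2) / 4"

lemma polar_commute: "polar x y = polar y x"
  by (simp add: polar_def add.commute norm_minus_commute)

lemma polar_self [simp]: "polar x x = (norm x)\<^sup>2"
  by (simp add: polar_def scaleR_2[symmetric] power_mult_distrib)

lemma polar_zero [simp]: "polar 0 x = 0" "polar x 0 = 0"
  by (simp_all add: polar_def)

section \<open>Left unit and the parallelogram inequality\<close>

locale absolute_valued_left_unital =
  fixes m :: "'a::real_normed_vector \<Rightarrow> 'a \<Rightarrow> 'a" and e :: 'a
  assumes bil: "bilinear m"
    and norm_mult [simp]: "norm (m x y) = norm x * norm y"
    and left_unit [simp]: "m e x = x"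
    and nontrivial: "\<exists>x::'a. x \<noteq> 0"
begin

lemmas mult_simps = bilinear_ladd[OF bil] bilinear_radd[OF bil] bilinear_lsub[OF bil]
  bilinear_rsub[OF bil] bilinear_lmul[OF bil] bilinear_rmul[OF bil]
  bilinear_lneg[OF bil] bilinear_rneg[OF bil]

lemma mult_zero [simp]: "m 0 x = 0" "m x 0 = 0"
  using bilinear_lzero[OF bil] bilinear_rzero[OF bil] by auto

lemma mult_sum: "m x (sum f S) = (\<Sum>i\<in>S. m x (f i))"
  by (induction S rule: infinite_finite_induct) (auto simp: mult_simps)

lemma norm_unit [simp]: "norm e = 1"
proof -
  obtain x :: 'a where "x \<noteq> 0" using nontrivial by blast
  moreover have "norm e * norm x = norm x" using norm_mult[of e x] by simp
  ultimately show ?thesis by simp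
qed

text \<open>Otherwise \<open>\<parallel>u + v\<parallel>\<^sup>2 + \<parallel>u - v\<parallel>\<^sup>2\<close> exceeds \<open>S = 2\<parallel>u\<parallel>\<^sup>2 + 2\<parallel>v\<parallel>\<^sup>2\<close>. A product of \<open>n\<close> factors
  \<open>L\<^sub>u \<plusminus> L\<^sub>v\<close> is a homogeneous polynomial in \<open>L\<^sub>u, L\<^sub>v\<close> with coefficients \<open>c\<^sub>j\<close>, and the weighted sum of
  the \<open>c\<^sub>j\<^sup>2\<close> satisfies a parallelogram law with constant \<open>S\<close>. Choosing each sign greedily makes
  this sum at most \<open>r\<^sup>n N\<^sup>2\<close> for some \<open>r < 1\<close>, where \<open>N\<close> is the norm of the product. By
  Cauchy--Schwarz \<open>N\<^sup>2\<close> is at most \<open>n + 1\<close> times the sum, a contradiction for large \<open>n\<close>.\<close>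
lemma commuting_parallelogram_le:
  assumes comm: "\<And>y. m u (m v y) = m v (m u y)"
  shows "(norm (u + v))\<^sup>2 + (norm (u - v))\<^sup>2 \<le> 2 * (norm u)\<^sup>2 + 2 * (norm v)\<^sup>2"
proof (rule ccontr)
  define S where "S = 2 * (norm u)\<^sup>2 + 2 * (norm v)\<^sup>2"
  define D where "D = (norm (u + v))\<^sup>2 + (norm (u - v))\<^sup>2"
  define r where "r = S / D"
  define P where "P k j = ((m u) ^^ k) (((m v) ^^ j) e)" for k j
  \<comment> \<open>The norm of the monomial \<open>P (n - j) j\<close>, used as the weight of
    \<open>c j\<close>.\<close>
  define w where "w n j = ((norm u) ^ (n - j) * (norm v) ^ j)" for n j :: nat
  assume "\<not> ?thesis"
  then have SD: "S < D" by (simp add: S_def D_def)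
  have S0: "S \<ge> 0" by (simp add: S_def)
  have r: "0 \<le> r" "r < 1" "r * D = S" using SD S0 by (auto simp: r_def divide_simps)
  have mu: "m u (P k j) = P (Suc k) j" for k j by (simp add: P_def)
  have mv: "m v (P k j) = P k (Suc j)" for k j
    by (induction k) (simp_all add: P_def comm[symmetric])
  have nP: "norm (P k j) = (norm u) ^ k * (norm v) ^ j" for k j
  proof (induction k)
    case 0
    show ?case by (induction j) (auto simp: P_def)
  qed (auto simp: mu[symmetric])
  have ex: "\<exists>c N. N > 0 \<and> norm (\<Sum>j\<le>n. c j *\<^sub>R P (n - j) j) = N
      \<and> (\<Sum>j\<le>n. (c j * w n j)\<^sup>2) \<le> r ^ n * N\<^sup>2 \<and> (\<forall>j>n. c j = 0)" for n
  proof (induction n)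
    case 0
    show ?case
      by (rule exI[of _ "\<lambda>j. if j = 0 then 1 else 0"], rule exI[of _ 1]) (simp add: nP w_def)
  next
    case (Suc n)
    then obtain c N where N: "N > 0" and nc: "norm (\<Sum>j\<le>n. c j *\<^sub>R P (n - j) j) = N"
      and Q: "(\<Sum>j\<le>n. (c j * w n j)\<^sup>2) \<le> r ^ n * N\<^sup>2" and c0: "\<And>j. j > n \<Longrightarrow> c j = 0" by blast
    \<comment> \<open>Multiplying by \<open>v\<close> raises the power of \<open>v\<close> by one,
      hence the shift; \<open>d s\<close> lists the coefficients after multiplying by
      \<open>u + s *\<^sub>R v\<close>.\<close>
    define c' where "c' j = (case j of 0 \<Rightarrow> 0 | Suc i \<Rightarrow> c i)" for j
    define d where "d s j = c j + s * c' j" for s :: real and j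
    define q where "q s = (\<Sum>j\<le>Suc n. (d s j * w (Suc n) j)\<^sup>2)" for s
    have e1: "(\<Sum>j\<le>Suc n. c j *\<^sub>R P (Suc n - j) j) = m u (\<Sum>j\<le>n. c j *\<^sub>R P (n - j) j)"
      by (simp add: mult_sum mult_simps mu c0 Suc_diff_le)
    have e2: "(\<Sum>j\<le>Suc n. c' j *\<^sub>R P (Suc n - j) j) = m v (\<Sum>j\<le>n. c j *\<^sub>R P (n - j) j)"
      by (subst sum.atMost_Suc_shift) (simp add: mult_sum mult_simps mv c'_def)
    have e: "(\<Sum>j\<le>Suc n. d s j *\<^sub>R P (Suc n - j) j) = m (u + s *\<^sub>R v) (\<Sum>j\<le>n. c j *\<^sub>R P (n - j) j)" for s
      unfolding mult_simps e1[symmetric] e2[symmetric] scaleR_sum_right sum.distrib[symmetric]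
      by (simp add: d_def algebra_simps del: sum.atMost_Suc)
    have q1: "(\<Sum>j\<le>Suc n. (c j * w (Suc n) j)\<^sup>2) = (norm u)\<^sup>2 * (\<Sum>j\<le>n. (c j * w n j)\<^sup>2)"
      by (simp add: c0 w_def sum_distrib_left Suc_diff_le power_mult_distrib mult_ac)
    have q2: "(\<Sum>j\<le>Suc n. (c' j * w (Suc n) j)\<^sup>2) = (norm v)\<^sup>2 * (\<Sum>j\<le>n. (c j * w n j)\<^sup>2)"
      by (subst sum.atMost_Suc_shift)
        (simp add: c'_def w_def sum_distrib_left power_mult_distrib mult_ac)
    have "q 1 + q (-1) = 2 * (\<Sum>j\<le>Suc n. (c j * w (Suc n) j)\<^sup>2) + 2 * (\<Sum>j\<le>Suc n. (c' j * w (Suc n) j)\<^sup>2)"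
      unfolding q_def d_def sum.distrib[symmetric] sum_distrib_left
      by (intro sum.cong refl) (simp add: power2_eq_square algebra_simps)
    also have "\<dots> = S * (\<Sum>j\<le>n. (c j * w n j)\<^sup>2)"
      unfolding q1 q2 S_def by (simp add: algebra_simps)
    also have "\<dots> \<le> S * (r ^ n * N\<^sup>2)" by (rule mult_left_mono[OF Q S0])
    also have "\<dots> = r ^ Suc n * (norm (u + v) * N)\<^sup>2 + r ^ Suc n * (norm (u - v) * N)\<^sup>2"
      unfolding r(3)[symmetric] D_def by (simp add: power_mult_distrib algebra_simps)
    finally have qs: "q 1 + q (-1) \<le> \<dots>" .
    have qnn: "q s \<ge> 0" for s unfolding q_def by (intro sum_nonneg) auto
    have "\<exists>s. norm (u + s *\<^sub>R v) > 0 \<and> q s \<le> r ^ Suc n * (norm (u + s *\<^sub>R v) * N)\<^sup>2"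
    proof (cases "norm (u + v) > 0 \<and> q 1 \<le> r ^ Suc n * (norm (u + v) * N)\<^sup>2")
      case True
      then show ?thesis by (intro exI[of _ 1]) auto
    next
      case False
      then have le: "q (-1) \<le> r ^ Suc n * (norm (u - v) * N)\<^sup>2"
        using qs qnn[of 1] by (cases "norm (u + v) > 0") auto
      \<comment> \<open>If \<open>u = v\<close>, the second term of the bound \<open>qs\<close>
        vanishes and the plus sign would have succeeded.\<close>
      have "norm (u - v) > 0"
      proof (rule ccontr)
        assume "\<not> 0 < norm (u - v)"
        then have "norm (u - v) = 0" by simp
        then have "q 1 \<le> r ^ Suc n * (norm (u + v) * N)\<^sup>2" "norm (u + v) > 0"
          using qs qnn[of "-1"] SD S0 by (auto simp: D_def)
        with False show False by simp
      qed
      with le show ?thesis by (intro exI[of _ "-1"]) auto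
    qed
    then obtain s where s: "norm (u + s *\<^sub>R v) > 0" "q s \<le> r ^ Suc n * (norm (u + s *\<^sub>R v) * N)\<^sup>2"
      by blast
    show ?case
    proof (intro exI[of _ "d s"] exI[of _ "norm (u + s *\<^sub>R v) * N"] conjI allI impI)
      show "norm (\<Sum>j\<le>Suc n. d s j *\<^sub>R P (Suc n - j) j) = norm (u + s *\<^sub>R v) * N"
        unfolding e by (simp add: nc)
      show "d s j = 0" if "Suc n < j" for j
        using that by (cases j) (auto simp: d_def c'_def c0)
    qed (use s N q_def in auto)
  qed
  have le1: "1 \<le> (real n + 1) * r ^ n" for n
  proof -
    obtain c N where N: "N > 0" and nc: "norm (\<Sum>j\<le>n. c j *\<^sub>R P (n - j) j) = N"
      and Q: "(\<Sum>j\<le>n. (c j * w n j)\<^sup>2) \<le> r ^ n * N\<^sup>2" using ex[of n] by blast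
    have "N \<le> (\<Sum>j\<le>n. norm (c j *\<^sub>R P (n - j) j))" unfolding nc[symmetric] by (rule norm_sum)
    also have "\<dots> = (\<Sum>j\<le>n. \<bar>c j * w n j\<bar>)" by (simp add: nP w_def abs_mult)
    finally have "N\<^sup>2 \<le> (\<Sum>j\<le>n. \<bar>c j * w n j\<bar>)\<^sup>2" using N by (intro power_mono) auto
    also have "\<dots> \<le> real (card {..n}) * (\<Sum>j\<le>n. \<bar>c j * w n j\<bar>\<^sup>2)"
      using sum_squared_le_sum_of_squares[of "\<lambda>j. \<bar>c j * w n j\<bar>" "{..n}"] by (simp add: mult.commute)
    also have "\<dots> \<le> (real n + 1) * (r ^ n * N\<^sup>2)"
      using Q by (simp add: mult_left_mono add.commute)
    finally have "N\<^sup>2 * 1 \<le> N\<^sup>2 * ((real n + 1) * r ^ n)" by (simp add: mult_ac)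
    then show ?thesis using N by (subst (asm) mult_le_cancel_left_pos) auto
  qed
  have "(\<lambda>n. real n * r ^ n + r ^ n) \<longlonglongrightarrow> 0 + 0"
    using r by (intro tendsto_add powser_times_n_limit_0 LIMSEQ_power_zero) auto
  then have "(1::real) \<le> 0"
    using le1 by (intro LIMSEQ_le_const[of _ 0 1]) (auto simp: algebra_simps)
  then show False by simp
qed

section \<open>Euclidean planes through the unit\<close>

text \<open>Left multiplication by \<open>e\<close> is the identity, so left multiplications by
  vectors of the plane commute. The inequality for \<open>u, v\<close> and the one for
  \<open>u + v, u - v\<close> combine to an equality.\<close>

lemma plane_parallelogram:
  "(norm (a *\<^sub>R e + b *\<^sub>R x + (c *\<^sub>R e + d *\<^sub>R x)))\<^sup>2 + (norm (a *\<^sub>R e + b *\<^sub>R x - (c *\<^sub>R e + d *\<^sub>R x)))\<^sup>2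
    = 2 * (norm (a *\<^sub>R e + b *\<^sub>R x))\<^sup>2 + 2 * (norm (c *\<^sub>R e + d *\<^sub>R x))\<^sup>2"
proof -
  have comm: "m (a *\<^sub>R e + b *\<^sub>R x) (m (c *\<^sub>R e + d *\<^sub>R x) y) = m (c *\<^sub>R e + d *\<^sub>R x) (m (a *\<^sub>R e + b *\<^sub>R x) y)"
    for a b c d y by (simp add: mult_simps algebra_simps)
  let ?u = "a *\<^sub>R e + b *\<^sub>R x" and ?v = "c *\<^sub>R e + d *\<^sub>R x"
  have "(norm (?u + ?v))\<^sup>2 + (norm (?u - ?v))\<^sup>2 \<le> 2 * (norm ?u)\<^sup>2 + 2 * (norm ?v)\<^sup>2"
    by (rule commuting_parallelogram_le) (rule comm)
  moreover have "(norm ((?u + ?v) + (?u - ?v)))\<^sup>2 + (norm ((?u + ?v) - (?u - ?v)))\<^sup>2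
     \<le> 2 * (norm (?u + ?v))\<^sup>2 + 2 * (norm (?u - ?v))\<^sup>2"
    by (rule commuting_parallelogram_le) (simp add: mult_simps algebra_simps)
  moreover have "(?u + ?v) + (?u - ?v) = 2 *\<^sub>R ?u" "(?u + ?v) - (?u - ?v) = 2 *\<^sub>R ?v"
    by (simp_all add: scaleR_2)
  ultimately show ?thesis by (simp add: power_mult_distrib)
qed

text \<open>The squared norm minus \<open>1 + s\<^sup>2 * (norm x)\<^sup>2\<close> satisfies
  Jensen's equation, so it is additive; being bounded on the unit interval it is linear, and its
  slope is read off at 1 and -1.\<close>

lemma norm_unit_line: "(norm (e + s *\<^sub>R x))\<^sup>2 = 1 + 2 * s * polar e x + s\<^sup>2 * (norm x)\<^sup>2"
proof -
  define N where "N s = (norm (e + s *\<^sub>R x))\<^sup>2" for s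
  define \<phi> where "\<phi> s = N s - 1 - s\<^sup>2 * (norm x)\<^sup>2" for s
  have "N (s + t) + N (s - t) = 2 * N s + 2 * t\<^sup>2 * (norm x)\<^sup>2" for s t
    using plane_parallelogram[of 1 s x 0 t]
    by (simp add: N_def algebra_simps power_mult_distrib)
  then have J: "\<phi> (s + t) + \<phi> (s - t) = 2 * \<phi> s" for s t
    by (simp add: \<phi>_def power2_eq_square algebra_simps)
  have "\<phi> 0 = 0" by (simp add: \<phi>_def N_def)
  then have dbl: "\<phi> (2 * s) = 2 * \<phi> s" for s using J[of s s] by simp
  have add: "\<phi> (s + t) = \<phi> s + \<phi> t" for s t
  proof -
    have "(s + t) / 2 + (s - t) / 2 = s" "(s + t) / 2 - (s - t) / 2 = t" by (simp_all add: field_simps)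
    moreover have "2 * ((s + t) / 2) = s + t" by simp
    ultimately show ?thesis using J[of "(s + t) / 2" "(s - t) / 2"] dbl[of "(s + t) / 2"] by metis
  qed
  have bd: "\<bar>\<phi> s\<bar> \<le> (1 + norm x)\<^sup>2 + 1 + (norm x)\<^sup>2" if "0 \<le> s" "s \<le> 1" for s
  proof -
    have "norm (e + s *\<^sub>R x) \<le> 1 + s * norm x"
      using norm_triangle_ineq[of e "s *\<^sub>R x"] that by simp
    also have "\<dots> \<le> 1 + norm x" using that by (simp add: mult_left_le_one_le)
    finally have "N s \<le> (1 + norm x)\<^sup>2" by (simp add: N_def power_mono)
    moreover have "N s \<ge> 0" by (simp add: N_def)
    moreover have "s\<^sup>2 * (norm x)\<^sup>2 \<le> (norm x)\<^sup>2"
      using that by (intro mult_left_le_one_le) (auto simp: power_le_one)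
    moreover have "0 \<le> s\<^sup>2 * (norm x)\<^sup>2" "0 \<le> (1 + norm x)\<^sup>2" by auto
    ultimately show ?thesis unfolding \<phi>_def by linarith
  qed
  have lin: "\<phi> s = s * \<phi> 1" for s
    by (rule additive_bounded_imp_linear[OF add bd])
  have "polar e x = (N 1 - N (-1)) / 4" by (simp add: polar_def N_def)
  also have "\<dots> = \<phi> 1 / 2" using lin[of "-1"] by (simp add: \<phi>_def)
  finally show ?thesis using lin[of s] by (simp add: \<phi>_def N_def mult_ac)
qed

lemma norm_plane:
  "(norm (a *\<^sub>R e + b *\<^sub>R x))\<^sup>2 = a\<^sup>2 + 2 * a * b * polar e x + b\<^sup>2 * (norm x)\<^sup>2"
proof (cases "a = 0")
  case False
  then have "a *\<^sub>R e + b *\<^sub>R x = a *\<^sub>R (e + (b / a) *\<^sub>R x)" by (simp add: algebra_simps)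
  then have "(norm (a *\<^sub>R e + b *\<^sub>R x))\<^sup>2 = a\<^sup>2 * (norm (e + (b / a) *\<^sub>R x))\<^sup>2"
    by (simp only: norm_scaleR power_mult_distrib power2_abs)
  also have "\<dots> = a\<^sup>2 + 2 * a * b * polar e x + b\<^sup>2 * (norm x)\<^sup>2"
    unfolding norm_unit_line using False by (simp add: field_simps power2_eq_square)
  finally show ?thesis .
qed (simp add: power_mult_distrib)

lemma polar_unit_scale: "polar e (t *\<^sub>R x) = t * polar e x"
  using norm_unit_line[of t x] norm_unit_line[of "-t" x] by (simp add: polar_def)

text \<open>\<open>polar e\<close> is the derivative at \<open>e\<close> of half the squared norm;
  the triangle inequality for \<open>e + t *\<^sub>R x\<close> and \<open>e + t *\<^sub>R y\<close>
  is compared to first order in \<open>t\<close>.\<close>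

lemma polar_unit_subadd: "polar e (x + y) \<le> polar e x + polar e y"
proof (rule ccontr)
  define \<delta> where "\<delta> = polar e (x + y) - polar e x - polar e y"
  define K where "K = 2 * (norm x)\<^sup>2 + 2 * (norm y)\<^sup>2"
  assume "\<not> ?thesis"
  then have d: "\<delta> > 0" by (simp add: \<delta>_def)
  have K: "K \<ge> 0" by (simp add: K_def)
  have le: "4 * t * \<delta> \<le> t\<^sup>2 * K" for t
  proof -
    have "2 *\<^sub>R e + t *\<^sub>R (x + y) = (e + t *\<^sub>R x) + (e + t *\<^sub>R y)" by (simp add: scaleR_2 algebra_simps)
    then have "norm (2 *\<^sub>R e + t *\<^sub>R (x + y)) \<le> norm (e + t *\<^sub>R x) + norm (e + t *\<^sub>R y)"
      by (metis norm_triangle_ineq)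
    then have "(norm (2 *\<^sub>R e + t *\<^sub>R (x + y)))\<^sup>2 \<le> (norm (e + t *\<^sub>R x) + norm (e + t *\<^sub>R y))\<^sup>2"
      by (intro power_mono) auto
    also have "\<dots> \<le> 2 * (norm (e + t *\<^sub>R x))\<^sup>2 + 2 * (norm (e + t *\<^sub>R y))\<^sup>2"
      using sum_squares_bound[of "norm (e + t *\<^sub>R x)" "norm (e + t *\<^sub>R y)"]
      by (simp add: power2_sum)
    finally have "4 + 4 * t * polar e (x + y) + t\<^sup>2 * (norm (x + y))\<^sup>2
      \<le> 4 + 4 * t * polar e x + 4 * t * polar e y + t\<^sup>2 * K"
      unfolding norm_plane norm_unit_line by (simp add: K_def algebra_simps)
    moreover have "0 \<le> t\<^sup>2 * (norm (x + y))\<^sup>2" by simp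
    ultimately have "4 * t * polar e (x + y) \<le> 4 * t * polar e x + 4 * t * polar e y + t\<^sup>2 * K" by linarith
    then show ?thesis by (simp add: \<delta>_def algebra_simps)
  qed
  \<comment> \<open>Small enough that \<open>t\<^sup>2 * K\<close> stays below
    \<open>4 * t * \<delta>\<close>.\<close>
  define t where "t = \<delta> / (K + 1)"
  have t: "t > 0" "t * K \<le> \<delta>" using d K by (auto simp: t_def field_simps)
  have "t * (4 * \<delta>) \<le> t * (t * K)" using le[of t] by (simp add: power2_eq_square mult_ac)
  with t d show False by simp
qed

lemma polar_unit_add: "polar e (x + y) = polar e x + polar e y"
  using polar_unit_subadd[of x y] polar_unit_subadd[of "x + y" "- y"] polar_unit_scale[of "-1" y]
  by simp

lemma polar_unit_minus: "polar e (- y) = - polar e y"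
  using polar_unit_scale[of "-1" y] by simp

lemma polar_unit_diff: "polar e (x - y) = polar e x - polar e y"
  using polar_unit_add[of x "- y"] by (simp add: polar_unit_minus)

section \<open>Left multiplication by vectors orthogonal to the unit\<close>

lemma norm_unit_orth:
  assumes "polar e h = 0"
  shows "(norm (a *\<^sub>R e + h))\<^sup>2 = a\<^sup>2 + (norm h)\<^sup>2"
  using norm_plane[of a 1 h] assms by simp

text \<open>The Krasnoselskii average of the isometry \<open>-L\<^sub>h\<^sup>2\<close> and the identity is again an isometry,
  so its orbits have steps of constant length \<open>d / 2\<close>; the Goebel--Kirk estimate makes the orbits
  unbounded unless \<open>d = 0\<close>.\<close>
lemma orth_mult_self:
  assumes h: "polar e h = 0"
  shows "m h (m h y) = - ((norm h)\<^sup>2 *\<^sub>R y)"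
proof -
  have main: "m k (m k y) = - y" if k: "polar e k = 0" and k1: "norm k = 1" for k
  proof -
    define U where "U y = - m k (m k y)" for y
    define R where "R y = (1 / 2) *\<^sub>R (y + U y)" for y
    define x where "x n = (R ^^ n) y" for n
    define d where "d = norm (U y - y)"
    have U_diff: "U a - U b = U (a - b)" for a b by (simp add: U_def mult_simps)
    have U_norm: "norm (U a) = norm a" for a by (simp add: U_def k1)
    have R_diff: "R a - R b = R (a - b)" for a b by (simp add: R_def U_diff[symmetric] algebra_simps)
    \<comment> \<open>This factorization makes \<open>R\<close> an isometry, since both factors have
      norm the square root of 2.\<close>
    have "m (e + k) (m (e - k) a) = 2 *\<^sub>R R a" for a
      by (simp add: R_def U_def mult_simps)
    moreover have "(norm (e + k))\<^sup>2 = 2" "(norm (e - k))\<^sup>2 = 2"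
      using norm_unit_line[of 1 k] norm_unit_line[of "-1" k] k k1 by auto
    then have "norm (e + k) * norm (e - k) = 2"
      by (metis norm_ge_zero power2_eq_imp_eq power2_eq_square zero_le_numeral mult_nonneg_nonneg power_mult_distrib)
    ultimately have R_norm: "norm (R a) = norm a" for a
      using norm_mult[of "e + k" "m (e - k) a"] by (simp add: mult.assoc[symmetric])
    have UR: "U (R a) = R (U a)" for a by (simp add: U_def R_def mult_simps algebra_simps)
    have x_Suc: "x (Suc n) = R (x n)" for n by (simp add: x_def)
    have x_norm: "norm (x n) = norm y" for n by (induction n) (auto simp: x_Suc R_norm x_def[of 0])
    have x_step: "norm (U (x n) - x n) = d" for n
      by (induction n) (auto simp: x_Suc UR R_diff R_norm x_def[of 0] d_def)
    have x_dist: "norm (x (i + n) - x i) \<le> real n * d / 2" for i n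
    proof (induction n)
      case (Suc n)
      have "x (Suc (i + n)) - x (i + n) = (1 / 2) *\<^sub>R (U (x (i + n)) - x (i + n))"
        by (simp add: x_Suc R_def algebra_simps scaleR_2[symmetric])
      then have "norm (x (Suc (i + n)) - x (i + n)) = d / 2" by (simp add: x_step)
      then have "norm (x (i + Suc n) - x i) \<le> d / 2 + norm (x (i + n) - x i)"
        using norm_triangle_ineq[of "x (Suc (i + n)) - x (i + n)" "x (i + n) - x i"] by simp
      with Suc.IH show ?case by (simp add: field_simps)
    qed simp
    have GK: "(1 + real n / 2) * d \<le> norm (U (x (i + n)) - x i)" for n i
    proof (induction n arbitrary: i)
      case 0
      then show ?case by (simp add: x_step)
    next
      case (Suc n)
      let ?u = "U (x (i + Suc n))"
      \<comment> \<open>\<open>x (Suc i)\<close> is the midpoint of \<open>x i\<close> and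
        \<open>U (x i)\<close>. As \<open>?u\<close> is far from the midpoint but within
        \<open>real (Suc n) * d / 2\<close> of \<open>U (x i)\<close>, it is even farther from
        \<open>x i\<close>.\<close>
      have "?u - x (Suc i) = (1 / 2) *\<^sub>R ((?u - U (x i)) + (?u - x i))"
        by (simp add: x_Suc R_def algebra_simps scaleR_2[symmetric])
      then have "norm (?u - x (Suc i)) \<le> (norm (?u - U (x i)) + norm (?u - x i)) / 2"
        using norm_triangle_ineq[of "?u - U (x i)" "?u - x i"] by simp
      moreover have "norm (?u - U (x i)) \<le> real (Suc n) * d / 2"
        using x_dist[of i "Suc n"] by (simp only: U_diff U_norm)
      moreover have "(1 + real n / 2) * d \<le> norm (?u - x (Suc i))"
        using Suc.IH[of "Suc i"] by simp
      ultimately show ?case by (simp add: field_simps)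
    qed
    have "d = 0"
    proof (rule ccontr)
      assume "d \<noteq> 0"
      then have d: "d > 0" by (simp add: d_def)
      obtain n where n: "4 * norm y < real n * d" using reals_Archimedean3[OF d] by auto
      have "(1 + real n / 2) * d \<le> norm (U (x n)) + norm (x 0)"
        using GK[of n 0] norm_triangle_ineq4[of "U (x n)" "x 0"] by simp
      then have "(1 + real n / 2) * d \<le> 2 * norm y" by (simp add: U_norm x_norm)
      with n d show False by (simp add: field_simps)
    qed
    then show ?thesis by (simp add: d_def U_def) (metis minus_minus)
  qed
  show ?thesis
  proof (cases "h = 0")
    case False
    define k where "k = (1 / norm h) *\<^sub>R h"
    have hk: "h = norm h *\<^sub>R k" using False by (simp add: k_def)
    have "m k (m k y) = - y"
      by (rule main) (use False h in \<open>auto simp: k_def polar_unit_scale\<close>)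
    then show ?thesis by (subst hk, subst (2) hk) (simp add: mult_simps power2_eq_square)
  qed simp
qed

text \<open>Clifford relation, by polarizing \<open>orth_mult_self\<close> at \<open>h + k\<close>
  and \<open>h - k\<close>, which stay orthogonal to \<open>e\<close>.\<close>

lemma orth_clifford:
  assumes "polar e h = 0" "polar e k = 0"
  shows "m h (m k y) + m k (m h y) = - ((2 * polar h k) *\<^sub>R y)"
proof -
  have p: "m (h + k) (m (h + k) y) = - ((norm (h + k))\<^sup>2 *\<^sub>R y)"
          "m (h - k) (m (h - k) y) = - ((norm (h - k))\<^sup>2 *\<^sub>R y)"
    by (rule orth_mult_self, simp add: polar_unit_add polar_unit_diff assms)+
  have "2 *\<^sub>R (m h (m k y) + m k (m h y)) = m (h + k) (m (h + k) y) - m (h - k) (m (h - k) y)"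
    by (simp add: mult_simps scaleR_2)
  also have "\<dots> = - ((4 * polar h k) *\<^sub>R y)" unfolding p by (simp add: polar_def algebra_simps diff_divide_distrib)
  finally have "(1 / 2) *\<^sub>R (2 *\<^sub>R (m h (m k y) + m k (m h y))) = (1 / 2) *\<^sub>R (- ((4 * polar h k) *\<^sub>R y))" by (rule arg_cong)
  then show ?thesis by simp
qed

section \<open>The inner product\<close>

definition im :: "'a \<Rightarrow> 'a" where "im x = x - polar e x *\<^sub>R e"

lemma im_orth [simp]: "polar e (im x) = 0"
  by (simp add: im_def polar_unit_diff polar_unit_scale)

lemma decomp: "x = polar e x *\<^sub>R e + im x" by (simp add: im_def)

lemma im_linear: "im (x + y) = im x + im y" "im (c *\<^sub>R x) = c *\<^sub>R im x"
  by (simp_all add: im_def polar_unit_add polar_unit_scale algebra_simps)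

lemma polar_decomp: "polar x y = polar e x * polar e y + polar (im x) (im y)"
proof -
  have "x + y = (polar e x + polar e y) *\<^sub>R e + (im x + im y)"
       "x - y = (polar e x - polar e y) *\<^sub>R e + (im x - im y)"
    by (simp_all add: im_def algebra_simps)
  then have "(norm (x + y))\<^sup>2 = (polar e x + polar e y)\<^sup>2 + (norm (im x + im y))\<^sup>2"
     "(norm (x - y))\<^sup>2 = (polar e x - polar e y)\<^sup>2 + (norm (im x - im y))\<^sup>2"
    by (simp_all add: norm_unit_orth polar_unit_add polar_unit_diff)
  then show ?thesis by (simp add: polar_def power2_sum power2_diff field_simps)
qed

text \<open>The right-hand side is visibly linear in \<open>h\<close>, which transfers linearity to
  \<open>polar\<close> on the complement of \<open>e\<close>.\<close>

lemma polar_orth_scaleR: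
  assumes "polar e h = 0" "polar e k = 0"
  shows "(2 * polar h k) *\<^sub>R e = - (m h (m k e) + m k (m h e))"
  using orth_clifford[OF assms, of e] by simp

lemma polar_add_left_orth:
  assumes "polar e h = 0" "polar e h' = 0" "polar e k = 0"
  shows "polar (h + h') k = polar h k + polar h' k"
proof -
  have "e \<noteq> 0" using norm_unit by force
  moreover have "(2 * polar (h + h') k) *\<^sub>R e = (2 * polar h k) *\<^sub>R e + (2 * polar h' k) *\<^sub>R e"
    using assms by (simp only: polar_orth_scaleR polar_unit_add add_0) (simp add: mult_simps)
  ultimately show ?thesis
    by (simp only: scaleR_cancel_right scaleR_add_left[symmetric]) simp
qed

lemma polar_scale_left_orth:
  assumes "polar e h = 0" "polar e k = 0"
  shows "polar (c *\<^sub>R h) k = c * polar h k"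
proof -
  have "e \<noteq> 0" using norm_unit by force
  moreover have "(2 * polar (c *\<^sub>R h) k) *\<^sub>R e = c *\<^sub>R ((2 * polar h k) *\<^sub>R e)"
    using assms by (simp only: polar_orth_scaleR polar_unit_scale mult_zero_right)
      (simp add: mult_simps scaleR_diff_right)
  ultimately show ?thesis
    by (simp only: scaleR_cancel_right scaleR_scaleR) simp
qed

lemma polar_add_left: "polar ((x::'a) + y) z = polar x z + polar y z"
  by (simp add: polar_decomp[of "x + y"] polar_decomp[of x] polar_decomp[of y] im_linear
      polar_unit_add polar_add_left_orth algebra_simps)

lemma polar_scale_left: "polar (c *\<^sub>R (x::'a)) z = c * polar x z"
proof -
  have "polar (im (c *\<^sub>R x)) (im z) = c * polar (im x) (im z)"
    by (simp add: im_linear polar_scale_left_orth)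
  then show ?thesis
    by (simp add: polar_decomp[of "c *\<^sub>R x"] polar_decomp[of x] polar_unit_scale algebra_simps)
qed

lemma polar_minus_left: "polar (- (x::'a)) z = - polar x z"
  using polar_scale_left[of "-1"] by simp

lemma polar_diff_left: "polar ((x::'a) - y) z = polar x z - polar y z"
  using polar_add_left[of x "- y"] by (simp add: polar_minus_left)

lemma polar_right:
  fixes x y z :: 'a
  shows "polar z (x + y) = polar z x + polar z y" "polar z (c *\<^sub>R x) = c * polar z x"
   "polar z (- x) = - polar z x" "polar z (x - y) = polar z x - polar z y"
  by (simp_all add: polar_commute[of z] polar_add_left polar_scale_left polar_minus_left polar_diff_left)

lemmas polar_simps = polar_add_left polar_scale_left polar_minus_left polar_diff_left polar_right

lemma polar_mult_left: "polar (m x y) (m x z) = (norm x)\<^sup>2 * polar y z"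
  unfolding polar_def by (simp add: bilinear_radd[OF bil, symmetric] bilinear_rsub[OF bil, symmetric]
      power_mult_distrib right_diff_distrib)

lemma polar_mult_right: "polar (m y x) (m z x) = (norm x)\<^sup>2 * polar y z"
  unfolding polar_def by (simp add: bilinear_ladd[OF bil, symmetric] bilinear_lsub[OF bil, symmetric]
      power_mult_distrib right_diff_distrib)

text \<open>Left multiplication by \<open>e + h\<close> scales the inner product by
  \<open>1 + (norm h)\<^sup>2\<close> and that by \<open>h\<close> scales it by
  \<open>(norm h)\<^sup>2\<close>, so the cross terms cancel.\<close>

lemma polar_skew:
  assumes "polar e h = 0"
  shows "polar (m h y) z = - polar y (m h z)"
proof -
  have "polar (m (e + h) y) (m (e + h) z) = (1 + (norm h)\<^sup>2) * polar y z"
    using norm_unit_orth[OF assms, of 1] by (simp add: polar_mult_left)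
  then show ?thesis by (simp add: mult_simps polar_simps polar_mult_left algebra_simps)
qed

lemma mult_decomp: "m x y = polar e x *\<^sub>R y + m (im x) y"
  by (subst decomp[of x]) (simp add: mult_simps)

lemma polar_adjoint: "polar (m x y) z = 2 * polar e x * polar y z - polar y (m x z)"
  unfolding mult_decomp[of x] by (simp add: polar_simps polar_skew)

lemma polar_mult_self: "polar (m x y) y = polar e x * (norm y)\<^sup>2"
  using polar_adjoint[of x y y] polar_commute[of y "m x y"] by simp

lemma mult_self_quadratic: "m x (m x y) = (2 * polar e x) *\<^sub>R m x y - (norm x)\<^sup>2 *\<^sub>R y"
proof -
  have "(norm x)\<^sup>2 = (polar e x)\<^sup>2 + (norm (im x))\<^sup>2"
    by (subst decomp[of x]) (simp only: norm_unit_orth im_orth)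
  then show ?thesis
    by (simp add: mult_decomp[of x] mult_simps orth_mult_self power2_eq_square algebra_simps
        mult_2[symmetric] scaleR_2[symmetric])
qed

section \<open>Third powers and right multiplication by the unit\<close>

lemma third_power_assoc_iff: "m (m w w) w = m w (m w w) \<longleftrightarrow> m w e = w"
proof
  assume eq: "m (m w w) w = m w (m w w)"
  show "m w e = w"
  proof (cases "w = 0")
    case False
    let ?a = "polar e w" and ?n = "(norm w)\<^sup>2"
    have n0: "?n \<noteq> 0" using False by simp
    have "polar (m (m w w) w) w = (2 * ?a\<^sup>2 - polar w (m w e)) * ?n"
      using polar_mult_self[of "m w w" w] polar_adjoint[of w w e] polar_commute[of e]
      by (simp add: power2_eq_square)
    moreover have "polar (m w (m w w)) w = 2 * ?a\<^sup>2 * ?n - ?n * ?n"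
      using polar_adjoint[of w "m w w" w] polar_mult_self[of w w]
      by (simp add: power2_eq_square)
    ultimately have "polar w (m w e) * ?n = ?n * ?n" using eq by (simp add: algebra_simps)
    then have "polar w (m w e) = ?n" using n0 mult_right_cancel by blast
    \<comment> \<open>\<open>m w e\<close> and \<open>w\<close> have equal norms, so this is the
      equality case of Cauchy-Schwarz.\<close>
    then have "polar (m w e - w) (m w e - w) = 0"
      by (simp only: polar_simps) (simp add: polar_commute[of "m w e"])
    then show ?thesis by simp
  qed simp
next
  assume we: "m w e = w"
  then have ww: "m w w = (2 * polar e w) *\<^sub>R w - (norm w)\<^sup>2 *\<^sub>R e"
    using mult_self_quadratic[of w e] by simp
  show "m (m w w) w = m w (m w w)"
    unfolding ww by (simp add: mult_simps we)
qed

text \<open>Expanding the square of \<open>x + e\<close> shows that right multiplication by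
  \<open>e\<close> fixes \<open>m x e + x\<close>.\<close>

lemma unit_right_involutive:
  assumes sq: "\<And>x. m (m x x) e = m x x"
  shows "m (m x e) e = x"
  using sq[of "x + e"] sq[of x] by (simp add: mult_simps)

text \<open>Gram-Schmidt for \<open>polar\<close>, one vector per induction step.\<close>

lemma ex_orth_component:
  assumes "finite (S :: 'a set)"
  shows "\<exists>p\<in>span S. \<forall>s\<in>S. polar s (x - p) = 0"
  using assms
proof (induction S arbitrary: x)
  case (insert s S)
  obtain p where p: "p \<in> span S" "\<forall>t\<in>S. polar t (x - p) = 0" using insert.IH by blast
  obtain q where q: "q \<in> span S" "\<forall>t\<in>S. polar t (s - q) = 0" using insert.IH by blast
  define d where "d = s - q"
  \<comment> \<open>If \<open>s\<close> equals its projection \<open>q\<close>, then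
    \<open>d = 0\<close>, division by zero gives \<open>c = 0\<close>, and no correction is
    made.\<close>
  define c where "c = polar d (x - p) / polar d d"
  let ?r = "x - (p + c *\<^sub>R d)"
  have rS: "\<forall>t\<in>S. polar t ?r = 0" using p q by (simp add: polar_simps d_def)
  have "subspace {t. polar t ?r = 0}" by (auto simp: subspace_def polar_add_left polar_scale_left)
  with rS have "span S \<subseteq> {t. polar t ?r = 0}" by (intro span_minimal) auto
  with q have "polar q ?r = 0" by auto
  moreover have "polar d (x - p) = c * polar d d"
    by (cases "d = 0") (simp_all add: c_def)
  then have "polar d ?r = 0" by (simp add: polar_right)
  ultimately have "polar s ?r = 0" by (simp add: d_def polar_diff_left)
  moreover have "p + c *\<^sub>R d \<in> span (insert s S)"
    unfolding d_def using p q by (meson insertI1 span_add span_base span_diff span_mono span_scale subset_insertI subsetD)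
  ultimately show ?case using rS by (intro bexI[of _ "p + c *\<^sub>R d"]) auto
qed simp

lemma ex_orth_unit_vector:
  assumes "\<not> finite_dimensional_space TYPE('a)" "finite (S :: 'a set)"
  obtains u where "norm u = 1" "\<And>s. s \<in> S \<Longrightarrow> polar s u = 0"
proof -
  obtain x where x: "x \<notin> span S" using assms by (auto simp: finite_dimensional_space_def)
  obtain p where p: "p \<in> span S" "\<forall>s\<in>S. polar s (x - p) = 0"
    using ex_orth_component[OF assms(2)] by blast
  have "x \<noteq> p" using x p by auto
  then show thesis
    using that[of "(1 / norm (x - p)) *\<^sub>R (x - p)"] p by (simp add: polar_right(2))
qed

end

section \<open>Finite dimension with a two-sided unit\<close>

locale absolute_valued_unital = absolute_valued_left_unital +
  assumes right_unit [simp]: "m x e = x"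
begin

lemma orth_anticommute:
  assumes "polar e x = 0" "polar e y = 0" "polar x y = 0"
  shows "m y x = - m x y"
  using orth_clifford[OF assms(1,2), of e] assms(3) by (simp add: eq_neg_iff_add_eq_0 add.commute)

lemma mult_orth:
  assumes "polar e x = 0" "polar x y = 0"
  shows "polar e (m x y) = 0"
  using polar_skew[OF assms(1), of y e] assms(2) by (simp add: polar_commute[of e] polar_commute[of y])

text \<open>Three sign changes: \<open>z\<close> anticommutes with \<open>m x y\<close>, the left
  multiplications by \<open>z\<close> and \<open>x\<close> anticommute, and \<open>z\<close>
  anticommutes with \<open>y\<close>.\<close>

lemma orth_antiassociative:
  assumes "polar e x = 0" "polar e y = 0" "polar e z = 0"
    and "polar x y = 0" "polar x z = 0" "polar y z = 0" "polar (m x y) z = 0"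
  shows "m x (m y z) = - m (m x y) z"
proof -
  have "m (m x y) z = - m z (m x y)"
    using orth_anticommute[of z "m x y"] assms mult_orth[of x y] by (simp add: polar_commute)
  also have "\<dots> = m x (m z y)"
    using orth_clifford[of z x y] assms by (simp add: polar_commute eq_neg_iff_add_eq_0 neg_eq_iff_add_eq_0)
  also have "m z y = - m y z"
    using orth_anticommute[of y z] assms by simp
  finally show ?thesis by (simp add: mult_simps)
qed

text \<open>Four generic orthogonal imaginary units cannot coexist: moving the brackets of
  \<open>i(j(lu))\<close> around the associativity pentagon reverses the sign at each of its five edges.\<close>
lemma finite_dimensional: "finite_dimensional_space TYPE('a)"
proof (rule ccontr)
  assume inf: "\<not> ?thesis"
  have ex: "\<exists>u. norm u = 1 \<and> (\<forall>s\<in>S. polar s u = 0)" if "finite S" for S :: "'a set"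
    using ex_orth_unit_vector[OF inf that] by metis
  obtain i where i: "norm i = 1" "polar e i = 0"
    using ex[of "{e}"] by auto
  obtain j where j: "norm j = 1" "polar e j = 0" "polar i j = 0"
    using ex[of "{e, i}"] by auto
  obtain l where l: "norm l = 1" "polar e l = 0" "polar i l = 0" "polar j l = 0" "polar (m i j) l = 0"
    using ex[of "{e, i, j, m i j}"] by auto
  \<comment> \<open>These are the conditions that the antiassociativity steps below put on
    \<open>u\<close>; skewness turns orthogonality of \<open>m l u\<close> to \<open>x\<close> into
    that of \<open>u\<close> to \<open>m l x\<close>.\<close>
  obtain u where u: "norm u = 1" "polar e u = 0" "polar i u = 0" "polar j u = 0" "polar l u = 0"
      "polar (m i j) u = 0" "polar (m l i) u = 0" "polar (m l j) u = 0" "polar (m j l) u = 0"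
      "polar (m l (m i j)) u = 0" "polar (m (m i j) l) u = 0" "polar (m i (m j l)) u = 0"
    using ex[of "{e, i, j, l, m i j, m l i, m l j, m j l, m l (m i j),
      m (m i j) l, m i (m j l)}"] by auto
  have ij: "polar e (m i j) = 0" using i j by (simp add: mult_orth)
  have jl: "polar e (m j l) = 0" using j l by (simp add: mult_orth)
  have lu: "polar e (m l u) = 0" using l u by (simp add: mult_orth)
  have "polar (m l u) x = - polar (m l x) u" for x
    using polar_skew[OF l(2), of u x] by (simp add: polar_commute[of u])
  then have lu': "polar x (m l u) = 0" if "polar (m l x) u = 0" for x
    using that by (simp add: polar_commute[of x])
  have ijl: "polar i (m j l) = 0"
    using polar_skew[OF j(2), of l i] orth_anticommute[of i j] i j l
    by (simp add: polar_simps polar_commute[of i "m j l"] polar_commute[of l "m i j"])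
  have "m i (m j (m l u)) = - m (m i j) (m l u)"
    by (rule orth_antiassociative) (use i j l u ij lu lu' in auto)
  also have "m (m i j) (m l u) = - m (m (m i j) l) u"
    by (rule orth_antiassociative) (use i j l u ij in auto)
  also have "m (m i j) l = - m i (m j l)"
    using orth_antiassociative[of i j l] i j l by simp
  also have "m (- m i (m j l)) u = m i (m (m j l) u)"
    using orth_antiassociative[of i "m j l" u] i j l u jl ijl by (simp add: mult_simps)
  also have "m (m j l) u = - m j (m l u)"
    using orth_antiassociative[of j l u] j l u by simp
  finally have "m i (m j (m l u)) = - m i (m j (m l u))" by (simp add: mult_simps)
  then have "2 *\<^sub>R m i (m j (m l u)) = 0" by (simp only: scaleR_2 eq_neg_iff_add_eq_0)
  moreover have "norm (m i (m j (m l u))) = 1" by (simp add: i j l u)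
  ultimately show False by simp
qed

end

section \<open>Degree bound and the equivalence\<close>

context absolute_valued_left_unital
begin

text \<open>Twisting by the involution \<open>x \<mapsto> xe\<close> turns the left unit into a two-sided one.\<close>
lemma finite_dimensional_if_involutive:
  assumes inv: "\<And>x. m (m x e) e = x"
  shows "finite_dimensional_space TYPE('a)"
proof -
  interpret T: absolute_valued_unital "\<lambda>x y. m (m x e) y" e
    by unfold_locales
      (use nontrivial in \<open>auto simp: bilinear_def inv mult_simps intro!: linearI\<close>)
  show ?thesis by (rule T.finite_dimensional)
qed

lemma dim_subalg_gen_le:
  assumes sq: "\<And>x. m (m x x) e = m x x"
  shows "dim (subalg_gen m x) \<le> 4"
proof -
  note inv = unit_right_involutive[OF sq]
  \<comment> \<open>\<open>a\<close> and \<open>b\<close> are the components of \<open>h\<close> for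
    the eigenvalues 1 and -1 of right multiplication by \<open>e\<close>.\<close>
  define h a b c where "h = im x" and "a = (1 / 2) *\<^sub>R (h + m h e)"
    and "b = (1 / 2) *\<^sub>R (h - m h e)" and "c = m a b"
  have polar_re: "polar (m y e) (m z e) = polar y z" for y z
    by (simp add: polar_mult_right)
  have ae: "m a e = a" and be: "m b e = - b"
    by (simp_all add: a_def b_def mult_simps inv algebra_simps)
  have h: "polar e h = 0" by (simp add: h_def)
  then have "polar e (m h e) = 0" using polar_re[of e h] by simp
  with h have a: "polar e a = 0" and b: "polar e b = 0"
    by (simp_all add: a_def b_def polar_simps)
  \<comment> \<open>Eigenvectors of an isometry for 1 and -1 are orthogonal.\<close>
  have ab: "polar a b = 0" using polar_re[of a b] by (simp add: ae be polar_simps)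
  \<comment> \<open>The opposite eigenvalues of \<open>a\<close> and \<open>b\<close> turn the
    Clifford anticommutation into commutation.\<close>
  have ba: "m b a = c"
    using orth_clifford[OF a b, of e] by (simp add: ae be ab mult_simps c_def)
  \<comment> \<open>Removing the squares of \<open>a\<close> and \<open>b\<close> leaves the cross
    term, twice \<open>c\<close>.\<close>
  have "m (m (a + b) (a + b)) e = m (a + b) (a + b)" by (rule sq)
  then have "2 *\<^sub>R m c e = 2 *\<^sub>R c"
    using sq[of a] sq[of b] by (simp add: mult_simps ba c_def[symmetric] scaleR_2)
  then have ce: "m c e = c" by simp
  have c: "polar e c = 0"
    using polar_skew[OF a, of b e] ab by (simp add: c_def ae polar_commute)
  have ca0: "polar c a = 0"
    using polar_mult_left[of a b e] b by (simp add: c_def ae polar_commute)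
  have cb0: "polar c b = 0"
    using polar_mult_self[of a b] a by (simp add: c_def)
  have aa: "m a a = - ((norm a)\<^sup>2 *\<^sub>R e)" using orth_mult_self[OF a, of e] by (simp add: ae)
  have bb: "m b b = (norm b)\<^sup>2 *\<^sub>R e" using orth_mult_self[OF b, of e] by (simp add: be mult_simps)
  have cc: "m c c = - ((norm c)\<^sup>2 *\<^sub>R e)" using orth_mult_self[OF c, of e] by (simp add: ce)
  have ac: "m a c = - ((norm a)\<^sup>2 *\<^sub>R b)" using orth_mult_self[OF a, of b] by (simp add: c_def)
  have bc: "m b c = - ((norm b)\<^sup>2 *\<^sub>R a)" using orth_mult_self[OF b, of a] by (simp add: ba)
  have ca: "m c a = (norm a)\<^sup>2 *\<^sub>R b"
    using orth_clifford[OF c a, of e] by (simp add: ae ce ca0 ac)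
  have cb: "m c b = - ((norm b)\<^sup>2 *\<^sub>R a)"
    using orth_clifford[OF c b, of e] by (simp add: be ce cb0 bc mult_simps) (metis minus_minus)
  let ?B = "{e, a, b, c}"
  have gen: "m y z \<in> span ?B" if "y \<in> ?B" "z \<in> ?B" for y z
    using that by (auto simp: ae be ce aa bb cc ac bc ca cb ba c_def[symmetric]
        intro!: span_neg span_scale intro: span_base)
  have sub1: "subspace {z. m y z \<in> span ?B}" for y
    by (auto simp: subspace_def mult_simps intro: span_zero span_add span_scale)
  have sub2: "subspace {y. m y z \<in> span ?B}" for z
    by (auto simp: subspace_def mult_simps intro: span_zero span_add span_scale)
  have "m y z \<in> span ?B" if "y \<in> ?B" "z \<in> span ?B" for y z
    using span_minimal[OF _ sub1[of y], of ?B] gen that by blast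
  then have closed: "m y z \<in> span ?B" if "y \<in> span ?B" "z \<in> span ?B" for y z
    using span_minimal[OF _ sub2[of z], of ?B] that by blast
  have "a + b = h" by (simp add: a_def b_def scaleR_add_right[symmetric] scaleR_2[symmetric] del: scaleR_add_right)
  then have "x = polar e x *\<^sub>R e + (a + b)" using decomp[of x] by (simp add: h_def)
  moreover have "polar e x *\<^sub>R e + (a + b) \<in> span ?B"
    by (intro span_add span_scale) (auto intro: span_base)
  ultimately have "x \<in> span ?B" by simp
  then have "subalg_gen m x \<subseteq> span ?B"
    unfolding subalg_gen_def using closed by (intro Inter_lower) auto
  then have "dim (subalg_gen m x) \<le> card ?B" by (intro dim_le_card) auto
  also have "\<dots> \<le> 4" by (simp add: card_insert_if)
  finally show ?thesis .
qed

end

theorem theorem3: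
  fixes m :: "'a::real_normed_vector \<Rightarrow> 'a \<Rightarrow> 'a" and e :: 'a
  assumes "absolute_valued_algebra m"
    and "is_left_unit m e"
  shows "((\<forall>x. associator m (m x x) (m x x) (m x x) = 0) \<longleftrightarrow> (\<forall>x. m (m x x) e = m x x))
    \<and> ((\<forall>x. m (m x x) e = m x x) \<longrightarrow>
        finite_dimensional_space TYPE('a) \<and> alg_degree m \<le> 4 \<and> (\<forall>x. m (m x e) e = x))"
proof -
  interpret absolute_valued_left_unital m e
    using assms by unfold_locales (auto simp: absolute_valued_algebra_def is_left_unit_def)
  have "alg_degree m \<le> 4" if "\<forall>x. m (m x x) e = m x x"
    unfolding alg_degree_def using that by (intro Least_le allI dim_subalg_gen_le) blast
  then show ?thesis
    by (auto simp: associator_def third_power_assoc_iff unit_right_involutive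
        intro: finite_dimensional_if_involutive)
qed

end
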